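(* Let $Q^0\subset\mathbb{R}^d$ be a cube, let $f:Q^0\to\mathbb{R}$ be any measurable function, let $m_f(Q^0)$ be a median of $f$ on $Q^0$, and let $\lambda=2^{-d-2}$. Then there is a collection $\mathscr{L}\subset\mathscr{D}(Q^0)$ of dyadic subcubes of $Q^0$ such that $$|f(x)-m_f(Q^0)|\leq 2\sum_{L\in\mathscr{L}}\omega_\lambda(f;L)\,1_L(x)\qquad\text{for almost every }x\in Q^0,$$ and $\mathscr{L}$ is sparse with constant $\tfrac12$: there are pairwise disjoint measurable subsets $E(L)\subset L$, $L\in\mathscr{L}$, with $|E(L)|\geq\tfrac12|L|$ for all $L\in\mathscr{L}$.
   Context: $|E|$ denotes the Lebesgue measure of $E\subset\mathbb{R}^d$, and $1_E$ its indicator function. $\mathscr{D}(Q^0)$ is the collection of dyadic subcubes of $Q^0$, i.e. the cubes obtained from $Q^0$ (including $Q^0$ itself) by repeatedly dividing a cube into $2^d$ congruent subcubes of half the side length. A median of a measurable function $f$ on a set $Q$ is any real number $m_f(Q)$ such that $$|Q\cap\{f>m_f(Q)\}|\leq\tfrac12|Q|,\qquad |Q\cap\{f<m_f(Q)\}|\leq\tfrac12|Q|.$$ The decreasing rearrangement of $f$ is $f^*(t):=\inf\{\alpha\geq 0:|\{|f|>\alpha\}|\leq t\}$. The oscillation of $f$ on $Q$, off a $\lambda$-fraction, is $$\omega_\lambda(f;Q):=\inf_{c\in\mathbb{R}}\,(1_Q(f-c))^*(\lambda|Q|),$$ where $1_Q(f-c)$ is understood to vanish outside $Q$. *)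

theory Defs
  imports "HOL-Analysis.Analysis"
begin

text \<open>Cubes are axis-parallel and half-open, so that a cube is the disjoint union of its
  \<open>2 ^ DIM('a)\<close> dyadic children.\<close>

definition half_open_cube :: "'a::euclidean_space \<Rightarrow> real \<Rightarrow> 'a set" where
  "half_open_cube a l = {x. \<forall>i\<in>Basis. a \<bullet> i \<le> x \<bullet> i \<and> x \<bullet> i < a \<bullet> i + l}"

definition is_cube :: "'a::euclidean_space set \<Rightarrow> bool" where
  "is_cube Q \<longleftrightarrow> (\<exists>a l. 0 < l \<and> Q = half_open_cube a l)"

definition dyadic_children :: "'a::euclidean_space set \<Rightarrow> 'a set set" where
  "dyadic_children Q =
    {half_open_cube b (l / 2) | a b l.
       0 < l \<and> Q = half_open_cube a l \<and> (\<forall>i\<in>Basis. b \<bullet> i = a \<bullet> i \<or> b \<bullet> i = a \<bullet> i + l / 2)}"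

inductive_set dyadic_subcubes :: "'a::euclidean_space set \<Rightarrow> 'a set set"
  for Q0 :: "'a set" where
  self: "Q0 \<in> dyadic_subcubes Q0"
| child: "Q \<in> dyadic_subcubes Q0 \<Longrightarrow> R \<in> dyadic_children Q \<Longrightarrow> R \<in> dyadic_subcubes Q0"

text \<open>Only the values of \<open>f\<close> on \<open>Q\<close> matter in \<open>is_median\<close> and \<open>oscillation\<close>, so functions on a
  cube are represented by total functions.\<close>

definition is_median :: "('a::euclidean_space \<Rightarrow> real) \<Rightarrow> 'a set \<Rightarrow> real \<Rightarrow> bool" where
  "is_median f Q m \<longleftrightarrow>
     emeasure lebesgue {x \<in> Q. f x > m} \<le> emeasure lebesgue Q / 2 \<and>
     emeasure lebesgue {x \<in> Q. f x < m} \<le> emeasure lebesgue Q / 2"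

text \<open>The rearrangement takes values in \<open>[0, \<infinity>]\<close>; the infimum of the empty set is \<open>\<infinity>\<close>.\<close>

definition decreasing_rearrangement :: "('a::euclidean_space \<Rightarrow> real) \<Rightarrow> ennreal \<Rightarrow> ennreal" where
  "decreasing_rearrangement f t =
     Inf {ennreal \<alpha> | \<alpha>. 0 \<le> \<alpha> \<and> emeasure lebesgue {x. \<bar>f x\<bar> > \<alpha>} \<le> t}"

definition oscillation :: "real \<Rightarrow> ('a::euclidean_space \<Rightarrow> real) \<Rightarrow> 'a set \<Rightarrow> ennreal" where
  "oscillation lam f Q =
     (INF c. decreasing_rearrangement (\<lambda>x. indicator Q x * (f x - c))
               (ennreal lam * emeasure lebesgue Q))"

definition sparse_family :: "real \<Rightarrow> 'a::euclidean_space set set \<Rightarrow> bool" where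
  "sparse_family \<eta> \<L> \<longleftrightarrow>
     (\<exists>E. disjoint_family_on E \<L> \<and>
          (\<forall>L\<in>\<L>. E L \<in> sets lebesgue \<and> E L \<subseteq> L \<and>
                 emeasure lebesgue (E L) \<ge> ennreal \<eta> * emeasure lebesgue L))"

end

theory Submission
  imports Defs
begin

text \<open>
Write \<open>med R\<close> for a median of \<open>f\<close> on a dyadic cube \<open>R\<close> and \<open>osc R\<close> for its oscillation off a
\<open>\<lambda>\<close>-fraction. Fix a dyadic cube \<open>Q\<close> and say that a subcube \<open>R\<close> of \<open>Q\<close> jumps if some dyadic child
\<open>S\<close> of \<open>R\<close> has \<open>\<bar>med S - med Q\<bar> > 2 osc Q\<close>. The stopping cubes of \<open>Q\<close> are the maximal subcubes that
jump. Four facts about them make up the proof; the first three rest on the observation that a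
median lies in every interval in which \<open>f\<close> takes its values on more than half of the cube
(\<open>median_in_majority_interval\<close>).

\<^item> \<open>Q\<close> itself does not jump (\<open>not_jumps_self\<close>): if \<open>\<bar>f - c\<bar> \<le> \<alpha>\<close> on \<open>Q\<close> off a \<open>\<lambda>\<close>-fraction, then, as
  \<open>\<lambda> = 2\<^sup>-\<^sup>d / 4\<close>, this inequality fails on at most a quarter of \<open>Q\<close> and on at most a quarter of each
  child, so that the medians of \<open>Q\<close> and of its children are within \<open>\<alpha>\<close> of \<open>c\<close>. The dyadic
  parent of a stopping cube \<open>R\<close> is therefore a subcube of \<open>Q\<close> that does not jump, which gives
  \<open>\<bar>med R - med Q\<bar> \<le> 2 osc Q\<close> (\<open>stopping_median_le\<close>).

\<^item> The stopping cubes cover at most half of \<open>Q\<close> (\<open>stopping_Union\<close>): with \<open>c\<close> and \<open>\<alpha>\<close> as above and \<open>\<alpha>\<close>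
  close to \<open>osc Q\<close>, every stopping cube has a child whose median is more than \<open>\<alpha>\<close> away from \<open>c\<close>.
  On half of this child, hence on a \<open>2\<^sup>-\<^sup>d / 2\<close>-fraction of the stopping cube,
  \<open>\<bar>f - c\<bar> > \<alpha>\<close>. This exceptional set has measure at most \<open>\<lambda> \<bar>Q\<bar>\<close> in total.

\<^item> Almost everywhere on \<open>Q\<close> off the stopping cubes, \<open>\<bar>f - med Q\<bar> \<le> 2 osc Q\<close>
  (\<open>near_median_off_stopping\<close>): a violating set of positive measure would fill more than half of some
  dyadic subcube (\<open>dense_subcube\<close>, a weak form of Lebesgue's density theorem), and the median of that
  subcube would then violate the same inequality, placing it inside a stopping cube.

\<^item> The stopping cubes of \<open>Q\<close> are pairwise disjoint, because dyadic cubes are nested or disjoint.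

The family \<open>\<L>\<close> is obtained from \<open>Q0\<close> by passing to stopping cubes again and again. The sets
\<open>E(Q) = Q - \<Union>(stopping cubes of Q)\<close> witness its sparsity, and they cover almost all of \<open>Q0\<close>, since
the \<open>n\<close>-th generation has measure at most \<open>2\<^sup>-\<^sup>n \<bar>Q0\<bar>\<close>. For a point of \<open>E(Q)\<close> one telescopes \<open>f - med Q0\<close>
along the finite chain of cubes of \<open>\<L>\<close> leading from \<open>Q0\<close> to \<open>Q\<close>, each step costing \<open>2 osc L\<close>.
\<close>


section \<open>Cubes and their dyadic subdivisions\<close>

abbreviation vol :: "'a::euclidean_space set \<Rightarrow> real" where
  "vol \<equiv> measure lebesgue"

lemma mem_half_open_cube:
  "x \<in> half_open_cube a l \<longleftrightarrow> (\<forall>i\<in>Basis. a \<bullet> i \<le> x \<bullet> i \<and> x \<bullet> i < a \<bullet> i + l)"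
  by (simp add: half_open_cube_def)

lemma half_open_cube_borel: "half_open_cube (a :: 'a::euclidean_space) l \<in> sets borel"
proof -
  have eq: "half_open_cube a l = (\<Inter>i\<in>Basis. {x. a \<bullet> i \<le> x \<bullet> i} \<inter> {x. x \<bullet> i < a \<bullet> i + l})"
    by (auto simp: half_open_cube_def)
  have "{x. a \<bullet> i \<le> x \<bullet> i} \<inter> {x. x \<bullet> i < a \<bullet> i + l} \<in> sets borel" for i :: 'a
    by (intro sets.Int) measurable
  then show ?thesis
    unfolding eq by (intro sets.finite_INT) auto
qed

lemma half_open_cube_measure:
  fixes a :: "'a::euclidean_space"
  assumes "0 < l"
  shows "half_open_cube a l \<in> lmeasurable" and "vol (half_open_cube a l) = l ^ DIM('a)"
proof -
  let ?b = "a + l *\<^sub>R One"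
  have ab: "a \<bullet> i \<le> ?b \<bullet> i" and diff: "(?b - a) \<bullet> i = l" if "i \<in> Basis" for i
    using that assms by (auto simp: inner_add_left)
  have sub: "box a ?b \<subseteq> half_open_cube a l" "half_open_cube a l \<subseteq> cbox a ?b"
    by (fastforce simp: box_def cbox_def half_open_cube_def inner_add_left)+
  have S: "half_open_cube a l \<in> sets lebesgue"
    using half_open_cube_borel sets_completionI_sets by (metis sets_lborel)
  have E: "emeasure lebesgue (box a ?b) = ennreal (l ^ DIM('a))"
    "emeasure lebesgue (cbox a ?b) = ennreal (l ^ DIM('a))"
    using ab diff by (simp_all add: emeasure_lborel_box_eq emeasure_lborel_cbox_eq)
  have "emeasure lebesgue (half_open_cube a l) \<le> ennreal (l ^ DIM('a))"
    using emeasure_mono[OF sub(2), of lebesgue] E by simp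
  moreover have "emeasure lebesgue (half_open_cube a l) \<ge> ennreal (l ^ DIM('a))"
    using emeasure_mono[OF sub(1) S] E by simp
  ultimately have eq: "emeasure lebesgue (half_open_cube a l) = ennreal (l ^ DIM('a))"
    by simp
  show "half_open_cube a l \<in> lmeasurable"
    using S eq by (simp add: fmeasurable_def)
  show "vol (half_open_cube a l) = l ^ DIM('a)"
    using eq assms by (simp add: measure_def)
qed

text \<open>The definition of the dyadic children quantifies over all ways of writing a set as a half-open
cube; since corner and side length are determined by the set, there is only one.\<close>

lemma half_open_cube_inject:
  fixes a b :: "'a::euclidean_space"
  assumes "0 < l" "0 < k" "half_open_cube a l = half_open_cube b k"
  shows "a = b \<and> l = k"
proof
  have "a \<in> half_open_cube a l" "b \<in> half_open_cube b k"
    using assms(1,2) by (auto simp: mem_half_open_cube)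
  then have "a \<in> half_open_cube b k" "b \<in> half_open_cube a l"
    using assms(3) by auto
  then show "a = b"
    by (metis mem_half_open_cube euclidean_eqI antisym)
  have "l ^ DIM('a) = k ^ DIM('a)"
    using assms half_open_cube_measure(2)[of l a] half_open_cube_measure(2)[of k b] by simp
  then show "l = k"
    using assms by (simp add: power_eq_iff_eq_base)
qed

lemma sum_Basis_inner:
  assumes "T \<subseteq> Basis" "i \<in> Basis"
  shows "(\<Sum>T) \<bullet> i = (if i \<in> T then 1 else 0)"
proof -
  have "(\<Sum>T) \<bullet> i = (\<Sum>j\<in>T. if j = i then 1 else 0)"
    unfolding inner_sum_left using assms by (intro sum.cong) (auto simp: inner_Basis subset_iff)
  then show ?thesis
    using assms finite_subset[OF assms(1)] by simp
qed

text \<open>The child whose corner is shifted by half a side length exactly in the directions in \<open>T\<close>.\<close>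

definition dyadic_child :: "'a::euclidean_space \<Rightarrow> real \<Rightarrow> 'a set \<Rightarrow> 'a set" where
  "dyadic_child a l T = half_open_cube (a + (l / 2) *\<^sub>R \<Sum>T) (l / 2)"

lemma dyadic_children_eq:
  fixes a :: "'a::euclidean_space"
  assumes "0 < l"
  shows "dyadic_children (half_open_cube a l) = dyadic_child a l ` Pow Basis"
proof (intro set_eqI iffI)
  fix S assume "S \<in> dyadic_children (half_open_cube a l)"
  then obtain a' b l' where *: "0 < l'" "half_open_cube a l = half_open_cube a' l'"
    "S = half_open_cube b (l' / 2)" "\<forall>i\<in>Basis. b \<bullet> i = a' \<bullet> i \<or> b \<bullet> i = a' \<bullet> i + l' / 2"
    unfolding dyadic_children_def by blast
  then have [simp]: "a' = a" "l' = l"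
    using half_open_cube_inject[OF assms *(1,2)] by auto
  define T where "T = {i \<in> Basis. b \<bullet> i \<noteq> a \<bullet> i}"
  have T: "T \<subseteq> Basis" "i \<in> T \<longleftrightarrow> b \<bullet> i \<noteq> a \<bullet> i" if "i \<in> Basis" for i
    using that by (auto simp: T_def)
  have "b = a + (l / 2) *\<^sub>R \<Sum>T"
  proof (rule euclidean_eqI)
    fix i :: 'a assume i: "i \<in> Basis"
    show "b \<bullet> i = (a + (l / 2) *\<^sub>R \<Sum>T) \<bullet> i"
      using *(4) T(2)[OF i] i unfolding inner_add_left inner_scaleR_left sum_Basis_inner[OF T(1)[OF i] i]
      by auto
  qed
  then have "S = dyadic_child a l T"
    using *(3) by (simp add: dyadic_child_def)
  then show "S \<in> dyadic_child a l ` Pow Basis"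
    by (auto simp: T_def)
next
  fix S assume "S \<in> dyadic_child a l ` Pow Basis"
  then obtain T where T: "T \<subseteq> Basis" "S = dyadic_child a l T"
    by blast
  have "\<forall>i\<in>Basis. (a + (l / 2) *\<^sub>R \<Sum>T) \<bullet> i = a \<bullet> i \<or> (a + (l / 2) *\<^sub>R \<Sum>T) \<bullet> i = a \<bullet> i + l / 2"
    using T(1) by (auto simp: inner_add_left sum_Basis_inner)
  then show "S \<in> dyadic_children (half_open_cube a l)"
    using assms T(2) unfolding dyadic_children_def dyadic_child_def by blast
qed

lemma mem_dyadic_child:
  assumes "T \<subseteq> Basis"
  shows "x \<in> dyadic_child a l T \<longleftrightarrow>
    (\<forall>i\<in>Basis. if i \<in> T then a \<bullet> i + l / 2 \<le> x \<bullet> i \<and> x \<bullet> i < a \<bullet> i + l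
              else a \<bullet> i \<le> x \<bullet> i \<and> x \<bullet> i < a \<bullet> i + l / 2)"
  unfolding dyadic_child_def mem_half_open_cube using assms
  by (intro ball_cong) (auto simp: inner_add_left sum_Basis_inner)

lemma dyadic_child_unique:
  assumes "T \<subseteq> Basis" "T' \<subseteq> Basis" "x \<in> dyadic_child a l T" "x \<in> dyadic_child a l T'"
  shows "T = T'"
proof -
  have "i \<in> T \<longleftrightarrow> i \<in> T'" if "i \<in> Basis" for i
    using assms(3,4) that unfolding mem_dyadic_child[OF assms(1)] mem_dyadic_child[OF assms(2)]
    by (smt (verit, best))
  then show ?thesis
    using assms(1,2) by blast
qed

lemma Union_dyadic_children:
  fixes Q :: "'a::euclidean_space set"
  assumes "is_cube Q"
  shows "\<Union>(dyadic_children Q) = Q"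
proof -
  obtain a l where Q: "0 < l" "Q = half_open_cube a l"
    using assms by (auto simp: is_cube_def)
  have sub: "x \<in> Q" if "T \<subseteq> Basis" "x \<in> dyadic_child a l T" for T x
    unfolding Q mem_half_open_cube
  proof
    fix i :: 'a assume "i \<in> Basis"
    then show "a \<bullet> i \<le> x \<bullet> i \<and> x \<bullet> i < a \<bullet> i + l"
      using that(2) Q(1) unfolding mem_dyadic_child[OF that(1)] by (auto split: if_splits dest!: bspec[of _ _ i])
  qed
  have in_child: "x \<in> dyadic_child a l {i \<in> Basis. a \<bullet> i + l / 2 \<le> x \<bullet> i}" if "x \<in> Q" for x
    using that unfolding Q by (subst mem_dyadic_child) (auto simp: mem_half_open_cube)
  have "\<Union>(dyadic_child a l ` Pow Basis) = Q"
  proof (intro equalityI subsetI)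
    fix x assume "x \<in> Q"
    then have "x \<in> dyadic_child a l {i \<in> Basis. a \<bullet> i + l / 2 \<le> x \<bullet> i}"
      by (rule in_child)
    then show "x \<in> \<Union> (dyadic_child a l ` Pow Basis)"
      by (rule UN_I[rotated]) simp
  qed (use sub in blast)
  then show ?thesis
    using dyadic_children_eq[OF Q(1), of a] Q(2) by simp
qed

lemma disjoint_dyadic_children:
  fixes Q :: "'a::euclidean_space set"
  assumes "is_cube Q"
  shows "disjoint (dyadic_children Q)"
proof -
  obtain a l where Q: "0 < l" "Q = half_open_cube a l"
    using assms by (auto simp: is_cube_def)
  have "dyadic_child a l T \<inter> dyadic_child a l T' = {}"
    if "T \<subseteq> Basis" "T' \<subseteq> Basis" "dyadic_child a l T \<noteq> dyadic_child a l T'" for T T'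
    using dyadic_child_unique[OF that(1,2)] that(3) by fast
  then show ?thesis
    unfolding Q dyadic_children_eq[OF Q(1)] by (intro disjointI) auto
qed

lemma finite_dyadic_children: "is_cube Q \<Longrightarrow> finite (dyadic_children Q)"
  by (auto simp: is_cube_def dyadic_children_eq)

lemma is_cube_dyadic_children: "R \<in> dyadic_children Q \<Longrightarrow> is_cube R"
  unfolding dyadic_children_def is_cube_def by (blast intro: half_gt_zero)

lemma dyadic_children_subset: "is_cube Q \<Longrightarrow> R \<in> dyadic_children Q \<Longrightarrow> R \<subseteq> Q"
  using Union_dyadic_children by blast

lemma cube_measure:
  assumes "is_cube Q"
  shows "Q \<in> lmeasurable" "0 < vol Q"
  using assms by (auto simp: is_cube_def half_open_cube_measure)

lemma vol_dyadic_children: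
  assumes "R \<in> dyadic_children (Q :: 'a::euclidean_space set)"
  shows "vol R = vol Q / 2 ^ DIM('a)"
  using assms unfolding dyadic_children_def
  by (auto simp: half_open_cube_measure(2) power_divide)

lemma dyadic_children_psubset:
  fixes Q :: "'a::euclidean_space set"
  assumes "is_cube Q" "R \<in> dyadic_children Q"
  shows "R \<subset> Q"
proof -
  have "(2::real) ^ DIM('a) > 1"
    by (simp add: one_less_power)
  then have "vol Q / 2 ^ DIM('a) < vol Q"
    using cube_measure(2)[OF assms(1)] by (simp add: divide_less_eq)
  then have "vol R < vol Q"
    using vol_dyadic_children[OF assms(2)] by simp
  then show ?thesis
    using dyadic_children_subset[OF assms] by auto
qed

text \<open>Keeping track of the generation of a subcube gives its volume, and turns nestedness into a
statement about the disjoint cubes of one generation and their ancestors.\<close>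

primrec dyadic_generation :: "'a::euclidean_space set \<Rightarrow> nat \<Rightarrow> 'a set set" where
  "dyadic_generation Q 0 = {Q}"
| "dyadic_generation Q (Suc k) = (\<Union>R\<in>dyadic_generation Q k. dyadic_children R)"

lemma dyadic_subcubes_eq: "dyadic_subcubes Q = (\<Union>k. dyadic_generation Q k)"
proof (intro set_eqI iffI)
  fix R assume "R \<in> dyadic_subcubes Q"
  then show "R \<in> (\<Union>k. dyadic_generation Q k)"
  proof induction
    case self
    show ?case
      by (rule UN_I[of 0]) auto
  next
    case (child R S)
    then obtain k where "R \<in> dyadic_generation Q k"
      by blast
    then show ?case
      using child by (intro UN_I[of "Suc k"]) auto
  qed
next
  fix R assume "R \<in> (\<Union>k. dyadic_generation Q k)"
  then obtain k where "R \<in> dyadic_generation Q k"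
    by blast
  then show "R \<in> dyadic_subcubes Q"
    by (induction k arbitrary: R) (auto intro: dyadic_subcubes.self dest: dyadic_subcubes.child)
qed

lemma dyadic_subcubes_trans:
  assumes "S \<in> dyadic_subcubes R" "R \<in> dyadic_subcubes Q"
  shows "S \<in> dyadic_subcubes Q"
  using assms by induction (auto dest: dyadic_subcubes.child)

context
  fixes Q :: "'a::euclidean_space set"
  assumes Q: "is_cube Q"
begin

lemma is_cube_subcube: "R \<in> dyadic_subcubes Q \<Longrightarrow> is_cube R"
  by (induction rule: dyadic_subcubes.induct) (auto simp: Q intro: is_cube_dyadic_children)

lemma is_cube_generation: "R \<in> dyadic_generation Q k \<Longrightarrow> is_cube R"
  using is_cube_subcube by (auto simp: dyadic_subcubes_eq)

lemma subcube_subset: "R \<in> dyadic_subcubes Q \<Longrightarrow> R \<subseteq> Q"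
proof (induction rule: dyadic_subcubes.induct)
  case (child R S)
  then show ?case
    using dyadic_children_subset[OF is_cube_subcube[OF child(1)] child(2)] by simp
qed simp

lemma Union_generation: "\<Union>(dyadic_generation Q k) = Q"
proof (induction k)
  case (Suc k)
  have "\<Union>(dyadic_generation Q (Suc k)) = (\<Union>R\<in>dyadic_generation Q k. \<Union>(dyadic_children R))"
    by auto
  also have "\<dots> = \<Union>(dyadic_generation Q k)"
    using is_cube_generation by (simp add: Union_dyadic_children)
  finally show ?case
    using Suc by simp
qed simp

lemma disjoint_generation: "disjoint (dyadic_generation Q k)"
proof (induction k)
  case (Suc k)
  show ?case
    unfolding disjoint_def
  proof (intro ballI impI)
    fix S S' assume S: "S \<in> dyadic_generation Q (Suc k)" "S' \<in> dyadic_generation Q (Suc k)" "S \<noteq> S'"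
    then obtain R R' where R: "R \<in> dyadic_generation Q k" "S \<in> dyadic_children R"
      "R' \<in> dyadic_generation Q k" "S' \<in> dyadic_children R'"
      by auto
    note sub = dyadic_children_subset[OF is_cube_generation[OF R(1)] R(2)]
      dyadic_children_subset[OF is_cube_generation[OF R(3)] R(4)]
    show "S \<inter> S' = {}"
    proof (cases "R = R'")
      case True
      then show ?thesis
        using disjoint_dyadic_children[OF is_cube_generation[OF R(1)]] R S(3)
        by (auto simp: disjoint_def)
    next
      case False
      then show ?thesis
        using Suc R sub by (fastforce simp: disjoint_def)
    qed
  qed
qed simp

lemma finite_generation: "finite (dyadic_generation Q k)"
  by (induction k) (auto intro: finite_dyadic_children is_cube_generation)

lemma countable_subcubes: "countable (dyadic_subcubes Q)"
  unfolding dyadic_subcubes_eq by (intro countable_UN) (auto intro: countable_finite finite_generation)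

lemma generation_ancestor:
  assumes "R \<in> dyadic_generation Q (n + k)"
  shows "\<exists>R'\<in>dyadic_generation Q n. R \<subseteq> R'"
  using assms
proof (induction k arbitrary: R)
  case (Suc k)
  then obtain R1 where R1: "R1 \<in> dyadic_generation Q (n + k)" "R \<in> dyadic_children R1"
    by auto
  then obtain R' where "R' \<in> dyadic_generation Q n" "R1 \<subseteq> R'"
    using Suc.IH by blast
  then show ?case
    using dyadic_children_subset[OF is_cube_generation[OF R1(1)] R1(2)] by blast
qed auto

lemma subcubes_nested:
  assumes "R \<in> dyadic_subcubes Q" "S \<in> dyadic_subcubes Q"
  shows "R \<subseteq> S \<or> S \<subseteq> R \<or> R \<inter> S = {}"
proof -
  have *: "S \<subseteq> R \<or> R \<inter> S = {}"
    if R: "R \<in> dyadic_generation Q n" and S: "S \<in> dyadic_generation Q k" and "n \<le> k" for n k R S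
  proof -
    obtain R' where "R' \<in> dyadic_generation Q n" "S \<subseteq> R'"
      using generation_ancestor[of S n "k - n"] S \<open>n \<le> k\<close> by auto
    then show ?thesis
      using disjoint_generation[of n] R unfolding disjoint_def by blast
  qed
  obtain n k where "R \<in> dyadic_generation Q n" "S \<in> dyadic_generation Q k"
    using assms unfolding dyadic_subcubes_eq by blast
  then show ?thesis
    using *[of R n S k] *[of S k R n] by (cases "n \<le> k") auto
qed

lemma vol_generation:
  "R \<in> dyadic_generation Q k \<Longrightarrow> vol R = vol Q / (2 ^ DIM('a)) ^ k"
proof (induction k arbitrary: R)
  case (Suc k)
  then obtain S where S: "S \<in> dyadic_generation Q k" "R \<in> dyadic_children S"
    by auto
  show ?case
    using vol_dyadic_children[OF S(2)] Suc.IH[OF S(1)] by simp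
qed simp

text \<open>A larger subcube lies in an earlier generation, so that only finitely many subcubes contain
  a given one; hence maximal subcubes exist for any property.\<close>

lemma finite_supercubes:
  assumes "R \<in> dyadic_subcubes Q"
  shows "finite {S \<in> dyadic_subcubes Q. R \<subseteq> S}"
proof -
  obtain n where n: "R \<in> dyadic_generation Q n"
    using assms unfolding dyadic_subcubes_eq by (rule UN_E)
  have "k \<le> n" if S: "S \<in> dyadic_generation Q k" "R \<subseteq> S" for S k
  proof -
    have "vol R \<le> vol S"
      using S(2) cube_measure(1)[OF is_cube_generation[OF n]] cube_measure(1)[OF is_cube_generation[OF S(1)]]
      by (intro measure_mono_fmeasurable) (auto simp: fmeasurable_def)
    then have "vol Q / (2 ^ DIM('a)) ^ n \<le> vol Q / (2 ^ DIM('a)) ^ k"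
      using vol_generation n S(1) by simp
    then have "(2 ^ DIM('a) :: real) ^ k \<le> (2 ^ DIM('a)) ^ n"
      using cube_measure(2)[OF Q] by (simp add: field_simps)
    then show "k \<le> n"
      by (subst (asm) power_increasing_iff) (simp_all add: one_less_power)
  qed
  then have "{S \<in> dyadic_subcubes Q. R \<subseteq> S} \<subseteq> (\<Union>k\<le>n. dyadic_generation Q k)"
    unfolding dyadic_subcubes_eq by blast
  then show ?thesis
    by (rule finite_subset) (simp add: finite_generation)
qed

lemma small_subcube:
  assumes "x \<in> Q" "open V" "x \<in> V"
  shows "\<exists>R\<in>dyadic_subcubes Q. x \<in> R \<and> R \<subseteq> V"
proof -
  obtain e where e: "0 < e" "ball x e \<subseteq> V"
    using assms openE by blast
  obtain a l where al: "0 < l" "Q = half_open_cube a l"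
    using Q by (auto simp: is_cube_def)
  have side: "\<exists>b. R = half_open_cube b (l / 2 ^ k)" if "R \<in> dyadic_generation Q k" for R k
    using that
  proof (induction k arbitrary: R)
    case (Suc k)
    then obtain b where "R \<in> dyadic_children (half_open_cube b (l / 2 ^ k))"
      by fastforce
    then show ?case
      using al(1) by (auto simp: dyadic_children_eq dyadic_child_def mult.commute)
  qed (use al in auto)
  \<comment> \<open>A cube of side length \<open>l / 2 ^ k\<close> has \<open>\<ell>\<^sub>1\<close>-diameter at most \<open>DIM('a) * l / 2 ^ k\<close>.\<close>
  obtain k where k: "DIM('a) * l / e < 2 ^ k"
    using real_arch_pow[of 2] by auto
  obtain R where R: "R \<in> dyadic_generation Q k" "x \<in> R"
    using Union_generation[of k] assms(1) by blast
  then obtain b where b: "R = half_open_cube b (l / 2 ^ k)"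
    using side by blast
  have "R \<subseteq> ball x e"
  proof
    fix y assume "y \<in> R"
    then have "\<bar>(x - y) \<bullet> i\<bar> \<le> l / 2 ^ k" if "i \<in> Basis" for i
      using R(2) that unfolding b mem_half_open_cube inner_diff_left by (smt (verit))
    then have "(\<Sum>i\<in>Basis. \<bar>(x - y) \<bullet> i\<bar>) \<le> DIM('a) * (l / 2 ^ k)"
      by (rule sum_bounded_above)
    also have "\<dots> < e"
      using k e(1) by (simp add: field_simps)
    finally show "y \<in> ball x e"
      using norm_le_l1[of "x - y"] by (simp add: dist_norm)
  qed
  then show ?thesis
    using R e unfolding dyadic_subcubes_eq by blast
qed

end

section \<open>Maximal subcubes\<close>

definition maximal_subcubes :: "'a::euclidean_space set \<Rightarrow> ('a set \<Rightarrow> bool) \<Rightarrow> 'a set set" where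
  "maximal_subcubes Q P =
    {R \<in> dyadic_subcubes Q. P R \<and> (\<forall>S\<in>dyadic_subcubes Q. R \<subset> S \<longrightarrow> \<not> P S)}"

lemma maximal_subcubesD:
  "R \<in> maximal_subcubes Q P \<Longrightarrow> R \<in> dyadic_subcubes Q \<and> P R"
  by (simp add: maximal_subcubes_def)

lemma subset_maximal_subcube:
  assumes "is_cube Q" "R \<in> dyadic_subcubes Q" "P R"
  shows "\<exists>M\<in>maximal_subcubes Q P. R \<subseteq> M"
proof -
  define X where "X = {S \<in> {S \<in> dyadic_subcubes Q. R \<subseteq> S}. P S}"
  have "finite X"
    unfolding X_def using finite_supercubes[OF assms(1,2)] by (rule finite_subset[rotated]) blast
  moreover have "X \<noteq> {}"
    using assms(2,3) by (auto simp: X_def)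
  ultimately have "\<exists>M\<in>X. \<forall>S\<in>X. M \<subseteq> S \<longrightarrow> M = S"
    by (rule finite_has_maximal)
  then obtain M where M: "M \<in> X" "\<forall>S\<in>X. M \<subseteq> S \<longrightarrow> M = S"
    by (rule bexE)
  then have "M \<in> maximal_subcubes Q P"
    unfolding maximal_subcubes_def X_def by (smt (verit) mem_Collect_eq psubset_eq subset_trans)
  then show ?thesis
    using M(1) by (auto simp: X_def)
qed

lemma disjoint_maximal_subcubes:
  assumes "is_cube Q"
  shows "disjoint (maximal_subcubes Q P)"
proof (rule disjointI)
  fix R S assume "R \<in> maximal_subcubes Q P" "S \<in> maximal_subcubes Q P" "R \<noteq> S"
  then show "R \<inter> S = {}"
    using subcubes_nested[OF assms, of R S] by (auto simp: maximal_subcubes_def)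
qed

text \<open>This is how stopping-time cubes are exploited: the dyadic parent of a maximal cube strictly
contains it and so fails the selection property.\<close>

lemma maximal_subcube_parent:
  assumes "is_cube Q" "R \<in> maximal_subcubes Q P" "R \<noteq> Q"
  shows "\<exists>S\<in>dyadic_subcubes Q. \<not> P S \<and> R \<in> dyadic_children S"
proof -
  have "R \<in> dyadic_subcubes Q"
    using assms(2) by (simp add: maximal_subcubes_def)
  then show ?thesis
  proof cases
    case (child S)
    then have "R \<subset> S"
      using dyadic_children_psubset is_cube_subcube[OF assms(1)] by blast
    then show ?thesis
      using child assms(2) by (auto simp: maximal_subcubes_def)
  qed (use assms(3) in simp)
qed

lemma countable_maximal_subcubes: "is_cube Q \<Longrightarrow> countable (maximal_subcubes Q P)"
  using countable_subcubes[of Q] by (rule countable_subset[rotated]) (auto simp: maximal_subcubes_def)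

lemma subcube_measure:
  assumes "is_cube Q" "R \<in> dyadic_subcubes Q"
  shows "R \<in> lmeasurable" "0 < vol R"
  using assms cube_measure is_cube_subcube by blast+

lemma emeasure_lmeasurable: "A \<in> lmeasurable \<Longrightarrow> emeasure lebesgue A = ennreal (vol A)"
  by (rule emeasure_eq_ennreal_measure) (auto dest: fmeasurableD2 simp del: emeasure_completion)

lemma vol_disjoint_Union_le:
  assumes "finite F" "disjoint F" "\<And>R. R \<in> F \<Longrightarrow> R \<in> lmeasurable"
    and AB: "A \<in> sets lebesgue" "B \<in> sets lebesgue"
    and le: "\<And>R. R \<in> F \<Longrightarrow> vol (B \<inter> R) \<le> c * vol (A \<inter> R)"
  shows "vol (B \<inter> \<Union>F) \<le> c * vol (A \<inter> \<Union>F)"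
proof -
  have eq: "vol (C \<inter> \<Union>F) = (\<Sum>R\<in>F. vol (C \<inter> R))" if C: "C \<in> sets lebesgue" for C
  proof -
    have "vol (\<Union>R\<in>F. C \<inter> R) = (\<Sum>R\<in>F. vol (C \<inter> R))"
    proof (rule measure_finite_Union[OF \<open>finite F\<close>])
      show "disjoint_family_on (\<lambda>R. C \<inter> R) F"
        using assms(2) by (auto simp: disjoint_family_on_def disjoint_def)
      show "(\<lambda>R. C \<inter> R) ` F \<subseteq> sets lebesgue"
        using assms(3) C by (auto simp: fmeasurable_def)
      show "emeasure lebesgue (C \<inter> R) \<noteq> \<infinity>" if "R \<in> F" for R
        using fmeasurable_Int_fmeasurable[OF assms(3)[OF that] C]
        by (auto simp: fmeasurable_def Int_commute)
    qed
    then show ?thesis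
      by (simp add: Int_UN_distrib flip: Int_Union)
  qed
  show ?thesis
    unfolding eq[OF AB(1)] eq[OF AB(2)] sum_distrib_left by (rule sum_mono) (rule le)
qed

text \<open>A substitute for Lebesgue's density theorem. Cover \<open>A\<close> by an open set \<open>V\<close> of measure less than
\<open>2 * vol A\<close>. The maximal dyadic subcubes inside \<open>V\<close> are disjoint and cover \<open>A\<close>; if \<open>A\<close> filled at most
half of each of them, its measure would be at most half of that of \<open>V\<close>.\<close>

lemma dense_subcube:
  assumes Q: "is_cube Q" and A: "A \<in> sets lebesgue" "A \<subseteq> Q" "0 < vol A"
  shows "\<exists>R\<in>dyadic_subcubes Q. vol R / 2 < vol (A \<inter> R)"
proof (rule ccontr)
  assume contra: "\<not> ?thesis"
  have lA: "A \<in> lmeasurable"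
    using fmeasurableI2[OF cube_measure(1)[OF Q] A(2,1)] .
  obtain V where V: "open V" "A \<subseteq> V" "V - A \<in> lmeasurable" "emeasure lebesgue (V - A) < ennreal (vol A)"
    using sets_lebesgue_outer_open[OF A(1,3)] by metis
  have "vol (V - A) < vol A"
    using V(4) emeasure_lmeasurable[OF V(3)] A(3) by (simp add: ennreal_less_iff del: emeasure_completion)
  moreover have V_eq: "V = A \<union> (V - A)"
    using V(2) by blast
  ultimately have vol_V: "vol V < 2 * vol A"
    using measure_Un_le[of A lebesgue "V - A"] A(1) V(3) by (auto simp: fmeasurable_def)
  have lV: "V \<in> lmeasurable"
    by (subst V_eq) (intro fmeasurable.Un lA V(3))
  define M where "M = maximal_subcubes Q (\<lambda>R. R \<subseteq> V)"
  note M = maximal_subcubesD[of _ Q "\<lambda>R. R \<subseteq> V", folded M_def]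
  have "vol (\<Union>R\<in>M. A \<inter> R) \<le> vol V / 2"
  proof (rule measure_UN_bound)
    show "countable M"
      unfolding M_def by (rule countable_maximal_subcubes[OF Q])
    show "A \<inter> R \<in> lmeasurable" if "R \<in> M" for R
      using subcube_measure(1)[OF Q, of R] M[OF that] lA by (auto intro: fmeasurable.Int)
    show "vol (\<Union>R\<in>F. A \<inter> R) \<le> vol V / 2" if F: "finite F" "F \<subseteq> M" for F
    proof -
      have lm: "R \<in> lmeasurable" if "R \<in> F" for R
        using subcube_measure(1)[OF Q, of R] M[of R] that F(2) by auto
      have "vol (A \<inter> \<Union>F) \<le> 1 / 2 * vol (UNIV \<inter> \<Union>F)"
      proof (rule vol_disjoint_Union_le[OF F(1)])
        show "disjoint F"
          using disjoint_maximal_subcubes[OF Q] F(2) unfolding M_def disjoint_def by blast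
        show "vol (A \<inter> R) \<le> 1 / 2 * vol (UNIV \<inter> R)" if "R \<in> F" for R
          using contra M[of R] that F(2) by (auto simp: not_less)
      qed (use lm A in auto)
      also have "vol (UNIV \<inter> \<Union>F) \<le> vol V"
      proof (rule measure_mono_fmeasurable)
        show "UNIV \<inter> \<Union>F \<subseteq> V"
          using M F(2) by blast
        show "UNIV \<inter> \<Union>F \<in> sets lebesgue"
          using lm F(1) by (auto simp: fmeasurable_def)
      qed (fact lV)
      finally show ?thesis
        by (simp add: Int_UN_distrib flip: Int_Union)
    qed
  qed
  moreover have "(\<Union>R\<in>M. A \<inter> R) = A"
  proof (intro equalityI subsetI)
    fix x assume x: "x \<in> A"
    then obtain R where R: "R \<in> dyadic_subcubes Q" "x \<in> R" "R \<subseteq> V"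
      using small_subcube[OF Q _ V(1), of x] A(2) V(2) by blast
    show "x \<in> (\<Union>R\<in>M. A \<inter> R)"
      using subset_maximal_subcube[OF Q R(1), of "\<lambda>R. R \<subseteq> V", OF R(3)] R(2) x unfolding M_def by blast
  qed blast
  ultimately show False
    using vol_V by simp
qed

section \<open>Medians and oscillation\<close>

context
  fixes f :: "'a::euclidean_space \<Rightarrow> real"
  assumes f: "f \<in> borel_measurable lebesgue"
begin

lemma level_set_lmeasurable:
  assumes "B \<in> sets borel" "Q \<in> lmeasurable"
  shows "{x \<in> Q. f x \<in> B} \<in> lmeasurable"
proof (rule fmeasurableI2[OF assms(2)])
  have "{x \<in> Q. f x \<in> B} = Q \<inter> (f -` B \<inter> space lebesgue)"
    by auto
  also have "\<dots> \<in> sets lebesgue"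
    using measurable_sets[OF f assms(1)] assms(2) by (intro sets.Int) (auto simp: fmeasurable_def)
  finally show "{x \<in> Q. f x \<in> B} \<in> sets lebesgue" .
qed auto

lemma level_set_compl:
  assumes "B \<in> sets borel" "Q \<in> lmeasurable"
  shows "vol {x \<in> Q. f x \<in> B} + vol {x \<in> Q. f x \<notin> B} = vol Q"
proof -
  have "{x \<in> Q. f x \<notin> B} = Q - {x \<in> Q. f x \<in> B}"
    by auto
  then show ?thesis
    using measure_Diff[of lebesgue Q "{x \<in> Q. f x \<in> B}"] level_set_lmeasurable[OF assms] assms(2)
    by (auto simp: fmeasurable_def)
qed

lemma level_set_mono:
  assumes "B \<subseteq> C" "B \<in> sets borel" "C \<in> sets borel" "Q \<in> lmeasurable"
  shows "vol {x \<in> Q. f x \<in> B} \<le> vol {x \<in> Q. f x \<in> C}"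
  using level_set_lmeasurable[OF assms(2,4)] level_set_lmeasurable[OF assms(3,4)] assms(1)
  by (intro measure_mono_fmeasurable) (auto simp: fmeasurable_def)

lemma level_set_limit:
  assumes "incseq B" "\<And>n. B n \<in> sets borel" "Q \<in> lmeasurable"
  shows "(\<lambda>n. vol {x \<in> Q. f x \<in> B n}) \<longlonglongrightarrow> vol {x \<in> Q. f x \<in> (\<Union>n. B n)}"
proof -
  have eq: "{x \<in> Q. f x \<in> (\<Union>n. B n)} = (\<Union>n. {x \<in> Q. f x \<in> B n})"
    by auto
  have "{x \<in> Q. f x \<in> (\<Union>n. B n)} \<in> lmeasurable"
    using assms by (intro level_set_lmeasurable) auto
  then show ?thesis
    unfolding eq
  proof (intro Lim_measure_incseq)
    show "range (\<lambda>n. {x \<in> Q. f x \<in> B n}) \<subseteq> sets lebesgue"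
      using level_set_lmeasurable[OF assms(2,3)] by (auto dest: fmeasurableD)
    show "incseq (\<lambda>n. {x \<in> Q. f x \<in> B n})"
      using assms(1) by (auto simp: incseq_def)
  qed (simp add: fmeasurableD2 infinity_ennreal_def del: emeasure_completion)
qed

lemma is_median_iff:
  assumes "Q \<in> lmeasurable"
  shows "is_median f Q m \<longleftrightarrow>
    vol {x \<in> Q. f x \<in> {m<..}} \<le> vol Q / 2 \<and> vol {x \<in> Q. f x \<in> {..<m}} \<le> vol Q / 2"
proof -
  have half: "emeasure lebesgue Q / 2 = ennreal (vol Q / 2)"
    using emeasure_lmeasurable[OF assms] by (simp add: ennreal_divide_numeral)
  have lm: "{x \<in> Q. m < f x} \<in> lmeasurable" "{x \<in> Q. f x < m} \<in> lmeasurable"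
    using level_set_lmeasurable[of "{m<..}" Q] level_set_lmeasurable[of "{..<m}" Q] assms by auto
  show ?thesis
    unfolding is_median_def half by (simp add: emeasure_lmeasurable lm)
qed

text \<open>An interval that misses \<open>m\<close> lies on one side of \<open>m\<close>, where \<open>f\<close> takes values on at most half of
\<open>Q\<close>. Applied to \<open>{c - \<alpha>..c + \<alpha>}\<close> this controls medians by the oscillation; applied to half-lines it
turns a large level set into a large median.\<close>

lemma median_in_majority_interval:
  assumes "is_median f Q m" "Q \<in> lmeasurable" "is_interval B" "B \<in> sets borel"
    and majority: "vol Q / 2 < vol {x \<in> Q. f x \<in> B}"
  shows "m \<in> B"
proof (rule ccontr)
  assume "m \<notin> B"
  then have "B \<subseteq> {m<..} \<or> B \<subseteq> {..<m}"
    using assms(3) unfolding is_interval_1 subset_iff greaterThan_iff lessThan_iff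
    by (metis linorder_neqE_linordered_idom less_imp_le)
  moreover have "\<not> B \<subseteq> {m<..}"
    using level_set_mono[of B "{m<..}" Q] assms majority unfolding is_median_iff[OF assms(2)] by auto
  moreover have "\<not> B \<subseteq> {..<m}"
    using level_set_mono[of B "{..<m}" Q] assms majority unfolding is_median_iff[OF assms(2)] by auto
  ultimately show False
    by blast
qed

text \<open>The infimum \<open>m\<close> of all \<open>t\<close> with \<open>vol {x \<in> Q. f x > t} \<le> vol Q / 2\<close> is a median, by continuity of the
measure along \<open>m + 1 / Suc n\<close> and \<open>m - 1 / Suc n\<close>.\<close>

lemma median_exists:
  assumes Q: "Q \<in> lmeasurable" "0 < vol Q"
  shows "\<exists>m. is_median f Q m"
proof -
  define T where "T = {t. vol {x \<in> Q. f x \<in> {t<..}} \<le> vol Q / 2}"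
  have up: "t \<in> T" if "s \<in> T" "s \<le> t" for s t
    using that level_set_mono[of "{t<..}" "{s<..}" Q] Q by (auto simp: T_def)
  have not_T: "vol {x \<in> Q. f x \<in> {..t}} < vol Q / 2" if "t \<notin> T" for t
    using that level_set_compl[of "{t<..}" Q] Q by (auto simp: T_def not_less not_le atMost_def)
  have "(\<lambda>n. vol {x \<in> Q. f x \<in> {..real n}}) \<longlonglongrightarrow> vol {x \<in> Q. f x \<in> (\<Union>n. {..real n})}"
    using Q by (intro level_set_limit) (auto simp: incseq_def)
  moreover have "(\<Union>n. {..real n}) = UNIV"
    by (auto simp: real_arch_simple)
  ultimately have "\<forall>\<^sub>F n in sequentially. vol Q / 2 < vol {x \<in> Q. f x \<in> {..real n}}"
    using Q by (intro order_tendstoD(1)) auto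
  then obtain k where "vol Q / 2 < vol {x \<in> Q. f x \<in> {..real k}}"
    by (auto simp: eventually_sequentially)
  then have s: "real k \<in> T"
    using not_T[of "real k"] by argo
  have "(\<lambda>n. vol {x \<in> Q. f x \<in> {- real n<..}}) \<longlonglongrightarrow> vol {x \<in> Q. f x \<in> (\<Union>n. {- real n<..})}"
    using Q by (intro level_set_limit) (auto simp: incseq_def)
  moreover have "(\<Union>n. {- real n<..}) = UNIV"
    by (auto simp: minus_less_iff reals_Archimedean2)
  ultimately have "\<forall>\<^sub>F n in sequentially. vol Q / 2 < vol {x \<in> Q. f x \<in> {- real n<..}}"
    using Q by (intro order_tendstoD(1)) auto
  then obtain n where n: "vol Q / 2 < vol {x \<in> Q. f x \<in> {- real n<..}}"
    by (auto simp: eventually_sequentially)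
  have bdd: "bdd_below T"
  proof (rule bdd_belowI)
    fix t assume t: "t \<in> T"
    have "- real n \<notin> T"
      using n by (simp add: T_def)
    then show "- real n \<le> t"
      using up[OF t, of "- real n"] by linarith
  qed
  define m where "m = Inf T"
  have inverse_Suc_le: "1 / real (Suc n) \<le> 1 / real (Suc k)" if "k \<le> n" for k n
    using that by (simp add: frac_le)
  have gt: "t \<in> T" if t: "m < t" for t
  proof -
    obtain u where "u \<in> T" "u < t"
      using cInf_lessD[of T t] s t unfolding m_def by auto
    then show ?thesis
      using up by simp
  qed
  have vol_gt: "vol {x \<in> Q. f x \<in> {m + 1 / Suc n<..}} \<le> vol Q / 2" for n
    using gt[of "m + 1 / Suc n"] by (simp add: T_def)
  have lt: "t \<notin> T" if "t < m" for t
    using cInf_lower[OF _ bdd, of t] that unfolding m_def by auto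
  have vol_le: "vol {x \<in> Q. f x \<in> {..m - 1 / Suc n}} \<le> vol Q / 2" for n
    by (intro less_imp_le not_T lt) simp
  have limit_gt: "(\<lambda>n. vol {x \<in> Q. f x \<in> {m + 1 / Suc n<..}}) \<longlonglongrightarrow> vol {x \<in> Q. f x \<in> (\<Union>n. {m + 1 / Suc n<..})}"
    using Q inverse_Suc_le by (intro level_set_limit) (auto simp: incseq_def inverse_eq_divide intro: order_le_less_trans)
  have Union_gt: "(\<Union>n. {m + 1 / Suc n<..}) = {m<..}"
  proof (intro equalityI subsetI)
    fix x assume "x \<in> {m<..}"
    then obtain n where "1 / Suc n < x - m"
      using nat_approx_posE[of "x - m"] by (metis diff_gt_0_iff_gt greaterThan_iff)
    then show "x \<in> (\<Union>n. {m + 1 / Suc n<..})"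
      by (intro UN_I[of n]) auto
  next
    fix x assume "x \<in> (\<Union>n. {m + 1 / Suc n<..})"
    then obtain n where "m + 1 / Suc n < x"
      by blast
    moreover have "0 < 1 / real (Suc n)"
      by simp
    ultimately show "x \<in> {m<..}"
      unfolding greaterThan_iff by linarith
  qed
  have limit_lt: "(\<lambda>n. vol {x \<in> Q. f x \<in> {..m - 1 / Suc n}}) \<longlonglongrightarrow> vol {x \<in> Q. f x \<in> (\<Union>n. {..m - 1 / Suc n})}"
    using Q inverse_Suc_le by (intro level_set_limit) (auto simp: incseq_def inverse_eq_divide)
  have Union_lt: "(\<Union>n. {..m - 1 / Suc n}) = {..<m}"
  proof (intro equalityI subsetI)
    fix x assume "x \<in> {..<m}"
    then obtain n where "1 / Suc n < m - x"
      using nat_approx_posE[of "m - x"] by (metis diff_gt_0_iff_gt lessThan_iff)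
    then show "x \<in> (\<Union>n. {..m - 1 / Suc n})"
      by (intro UN_I[of n]) auto
  next
    fix x assume "x \<in> (\<Union>n. {..m - 1 / Suc n})"
    then obtain n where "x \<le> m - 1 / Suc n"
      by blast
    moreover have "0 < 1 / real (Suc n)"
      by simp
    ultimately show "x \<in> {..<m}"
      unfolding lessThan_iff by linarith
  qed
  have "vol {x \<in> Q. f x \<in> {m<..}} \<le> vol Q / 2"
    by (rule LIMSEQ_le_const2[OF limit_gt[unfolded Union_gt]]) (intro exI allI impI vol_gt)
  moreover have "vol {x \<in> Q. f x \<in> {..<m}} \<le> vol Q / 2"
    by (rule LIMSEQ_le_const2[OF limit_lt[unfolded Union_lt]]) (intro exI allI impI vol_le)
  ultimately show ?thesis
    using is_median_iff[OF Q(1)] by blast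
qed

lemma oscillation_lessD:
  assumes "oscillation lam f Q < ennreal t" "Q \<in> lmeasurable" "0 \<le> lam"
  obtains c \<alpha> where "0 \<le> \<alpha>" "\<alpha> < t" "vol {x \<in> Q. f x \<notin> {c - \<alpha>..c + \<alpha>}} \<le> lam * vol Q"
proof -
  obtain c where "decreasing_rearrangement (\<lambda>x. indicator Q x * (f x - c))
      (ennreal lam * emeasure lebesgue Q) < ennreal t"
    using assms(1) unfolding oscillation_def INF_less_iff by (rule bexE)
  then obtain a where
    a: "a \<in> {ennreal \<alpha> | \<alpha>. 0 \<le> \<alpha> \<and> emeasure lebesgue {x. \<bar>indicator Q x * (f x - c)\<bar> > \<alpha>}
      \<le> ennreal lam * emeasure lebesgue Q}" "a < ennreal t"
    unfolding decreasing_rearrangement_def Inf_less_iff by (rule bexE)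
  from a(1) obtain \<alpha> where c: "0 \<le> \<alpha>" "a = ennreal \<alpha>"
    and le: "emeasure lebesgue {x. \<bar>indicator Q x * (f x - c)\<bar> > \<alpha>} \<le> ennreal lam * emeasure lebesgue Q"
    by (elim CollectE exE conjE)
  have eq: "{x. \<bar>indicator Q x * (f x - c)\<bar> > \<alpha>} = {x \<in> Q. f x \<in> - {c - \<alpha>..c + \<alpha>}}"
    using c(1) by (auto simp: indicator_def abs_if split: if_splits)
  have lm: "{x \<in> Q. f x \<in> - {c - \<alpha>..c + \<alpha>}} \<in> lmeasurable"
    using assms(2) by (intro level_set_lmeasurable) auto
  have "ennreal (vol {x \<in> Q. f x \<in> - {c - \<alpha>..c + \<alpha>}}) \<le> ennreal (lam * vol Q)"
    using le unfolding eq emeasure_lmeasurable[OF lm] emeasure_lmeasurable[OF assms(2)]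
    using assms(3) by (simp add: ennreal_mult)
  then have "vol {x \<in> Q. f x \<notin> {c - \<alpha>..c + \<alpha>}} \<le> lam * vol Q"
    using assms(3) by simp
  moreover have "\<alpha> < t"
    using c a(2) by (simp add: ennreal_less_iff)
  ultimately show ?thesis
    using c(1) by (intro that)
qed

lemma median_near_center:
  assumes "is_median f Q m" "Q \<in> lmeasurable"
    and "vol {x \<in> Q. f x \<notin> {c - \<alpha>..c + \<alpha>}} < vol Q / 2"
  shows "\<bar>m - c\<bar> \<le> \<alpha>"
proof -
  have "m \<in> {c - \<alpha>..c + \<alpha>}"
    using assms(3) level_set_compl[of "{c - \<alpha>..c + \<alpha>}" Q] assms(2)
    by (intro median_in_majority_interval[OF assms(1,2)]) (auto simp: is_interval_cc)
  then show ?thesis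
    by auto
qed

end

section \<open>The stopping cubes\<close>

lemma ennreal_less_half:
  assumes "2 * a < ennreal t"
  shows "a < ennreal (t / 2)"
proof (rule ccontr)
  assume "\<not> ?thesis"
  then have "2 * ennreal (t / 2) \<le> 2 * a"
    by (intro mult_left_mono) (auto simp: not_less)
  moreover have "2 * ennreal (t / 2) = ennreal t"
    by (cases "0 \<le> t") (simp_all add: ennreal_neg flip: ennreal_numeral ennreal_mult)
  ultimately show False
    using assms by simp
qed

context
  fixes f :: "'a::euclidean_space \<Rightarrow> real" and Q0 :: "'a set" and med :: "'a set \<Rightarrow> real" and lam :: real
  assumes f: "f \<in> borel_measurable lebesgue"
    and Q0: "is_cube Q0"
    and med: "\<And>R. R \<in> dyadic_subcubes Q0 \<Longrightarrow> is_median f R (med R)"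
    and lam: "lam = 1 / (4 * 2 ^ DIM('a))"
begin

text \<open>The median is tested on the children of \<open>R\<close> instead of \<open>R\<close> itself, so that for a maximal jumping
cube \<open>R\<close> the failure of its parent to jump bounds \<open>med R\<close>.\<close>

definition jumps :: "'a set \<Rightarrow> 'a set \<Rightarrow> bool" where
  "jumps Q R \<longleftrightarrow> (\<exists>S\<in>dyadic_children R. 2 * oscillation lam f Q < ennreal \<bar>med S - med Q\<bar>)"

definition stopping_cubes :: "'a set \<Rightarrow> 'a set set" where
  "stopping_cubes Q = maximal_subcubes Q (jumps Q)"

lemma lam_nonneg: "0 \<le> lam"
  by (simp add: lam)

text \<open>A subset of \<open>Q\<close> of relative size \<open>lam\<close> fills at most a quarter of \<open>Q\<close> and of each of its children.\<close>

lemma median_of_child_near_center: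
  assumes Q: "Q \<in> dyadic_subcubes Q0" and S: "S = Q \<or> S \<in> dyadic_children Q"
    and le: "vol {x \<in> Q. f x \<notin> {c - \<alpha>..c + \<alpha>}} \<le> lam * vol Q"
  shows "\<bar>med S - c\<bar> \<le> \<alpha>"
proof -
  have S0: "S \<in> dyadic_subcubes Q0"
    using Q S dyadic_subcubes.child by blast
  have sub: "S \<subseteq> Q"
    using S dyadic_children_subset[OF is_cube_subcube[OF Q0 Q]] by blast
  have lQ: "Q \<in> lmeasurable" and lS: "S \<in> lmeasurable"
    using subcube_measure[OF Q0] Q S0 by blast+
  have "{x \<in> S. f x \<in> - {c - \<alpha>..c + \<alpha>}} \<in> lmeasurable" "{x \<in> Q. f x \<in> - {c - \<alpha>..c + \<alpha>}} \<in> lmeasurable"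
    using lQ lS by (intro level_set_lmeasurable[OF f]; simp)+
  then have "vol {x \<in> S. f x \<notin> {c - \<alpha>..c + \<alpha>}} \<le> vol {x \<in> Q. f x \<notin> {c - \<alpha>..c + \<alpha>}}"
    using sub by (intro measure_mono_fmeasurable) (auto dest: fmeasurableD)
  also have "\<dots> \<le> vol Q / 2 ^ DIM('a) / 4"
    using le by (simp add: lam)
  also have "vol Q / 2 ^ DIM('a) \<le> vol S"
  proof -
    have "vol Q / 2 ^ DIM('a) \<le> vol Q"
      by (simp add: divide_le_eq mult_le_cancel_left1)
    then show ?thesis
      using S vol_dyadic_children by fastforce
  qed
  also have "vol S / 4 < vol S / 2"
    using subcube_measure(2)[OF Q0 S0] by simp
  finally show ?thesis
    using median_near_center[OF f med[OF S0] lS] by simp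
qed

lemma not_jumps_self:
  assumes "Q \<in> dyadic_subcubes Q0"
  shows "\<not> jumps Q Q"
proof
  assume "jumps Q Q"
  then obtain S where S: "S \<in> dyadic_children Q" "2 * oscillation lam f Q < ennreal \<bar>med S - med Q\<bar>"
    by (auto simp: jumps_def)
  obtain c \<alpha> where c: "0 \<le> \<alpha>" "\<alpha> < \<bar>med S - med Q\<bar> / 2"
    "vol {x \<in> Q. f x \<notin> {c - \<alpha>..c + \<alpha>}} \<le> lam * vol Q"
    using oscillation_lessD[OF f ennreal_less_half[OF S(2)] subcube_measure(1)[OF Q0 assms] lam_nonneg]
    by metis
  then show False
    using median_of_child_near_center[OF assms _ c(3), of S] S(1)
      median_of_child_near_center[OF assms _ c(3), of Q] by (auto simp: abs_le_iff abs_if split: if_splits)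
qed

context
  fixes Q assumes Q: "Q \<in> dyadic_subcubes Q0"
begin

lemma cube_Q: "is_cube Q"
  using is_cube_subcube[OF Q0 Q] .

lemma stopping_subcube:
  assumes "R \<in> stopping_cubes Q"
  shows "R \<in> dyadic_subcubes Q" "R \<in> dyadic_subcubes Q0" "jumps Q R"
  using maximal_subcubesD[of R Q "jumps Q"] assms dyadic_subcubes_trans[OF _ Q]
  by (auto simp: stopping_cubes_def)

lemma stopping_psubset: "R \<in> stopping_cubes Q \<Longrightarrow> R \<subset> Q"
  using stopping_subcube[of R] not_jumps_self[OF Q] subcube_subset[OF cube_Q] by blast

lemma stopping_median_le:
  assumes "R \<in> stopping_cubes Q"
  shows "ennreal \<bar>med R - med Q\<bar> \<le> 2 * oscillation lam f Q"
proof -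
  have "R \<noteq> Q"
    using stopping_psubset[OF assms] by blast
  then obtain S where "\<not> jumps Q S" "R \<in> dyadic_children S"
    using maximal_subcube_parent[OF cube_Q] assms unfolding stopping_cubes_def by blast
  then show ?thesis
    by (auto simp: jumps_def not_less)
qed

lemma countable_stopping: "countable (stopping_cubes Q)"
  unfolding stopping_cubes_def by (rule countable_maximal_subcubes[OF cube_Q])

lemma disjoint_stopping: "disjoint (stopping_cubes Q)"
  unfolding stopping_cubes_def by (rule disjoint_maximal_subcubes[OF cube_Q])

text \<open>For a finite family the least of the jumps is still larger than \<open>2 * oscillation lam f Q\<close>, so one
pair \<open>c\<close>, \<open>\<alpha>\<close> in the definition of the oscillation serves all its members. In each of them a
child then has its median outside \<open>{c - \<alpha>..c + \<alpha>}\<close>, so \<open>f\<close> leaves this interval on half of the child.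
Infinite families follow by countable additivity, without the infimum in the oscillation having to
be attained.\<close>

lemma vol_finite_stopping:
  assumes F: "finite F" "F \<subseteq> stopping_cubes Q"
  shows "vol (\<Union>F) \<le> vol Q / 2"
proof (cases "F = {}")
  case False
  note sub = stopping_subcube[OF subsetD[OF F(2)]]
  have "\<forall>R\<in>F. \<exists>S\<in>dyadic_children R. 2 * oscillation lam f Q < ennreal \<bar>med S - med Q\<bar>"
    using sub(3) by (auto simp: jumps_def)
  then obtain S where S: "\<And>R. R \<in> F \<Longrightarrow> S R \<in> dyadic_children R"
    "\<And>R. R \<in> F \<Longrightarrow> 2 * oscillation lam f Q < ennreal \<bar>med (S R) - med Q\<bar>"
    by metis
  define t where "t = Min ((\<lambda>R. \<bar>med (S R) - med Q\<bar>) ` F)"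
  have "t \<in> (\<lambda>R. \<bar>med (S R) - med Q\<bar>) ` F"
    unfolding t_def using F(1) False by (intro Min_in) auto
  then have "2 * oscillation lam f Q < ennreal t"
    using S(2) by blast
  then obtain c \<alpha> where c: "0 \<le> \<alpha>" "\<alpha> < t / 2"
    "vol {x \<in> Q. f x \<notin> {c - \<alpha>..c + \<alpha>}} \<le> lam * vol Q"
    using oscillation_lessD[OF f ennreal_less_half subcube_measure(1)[OF Q0 Q] lam_nonneg]
    by metis
  define B where "B = {x \<in> Q. f x \<in> - {c - \<alpha>..c + \<alpha>}}"
  have lB: "B \<in> lmeasurable"
    unfolding B_def using subcube_measure(1)[OF Q0 Q] by (intro level_set_lmeasurable[OF f]) auto
  have big: "vol R \<le> 2 * 2 ^ DIM('a) * vol (B \<inter> R)" if R: "R \<in> F" for R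
  proof -
    have S0: "S R \<in> dyadic_subcubes Q0"
      using S(1)[OF R] sub(2)[OF R] dyadic_subcubes.child by blast
    have "2 * \<alpha> < \<bar>med (S R) - med Q\<bar>"
      using c(2) Min_le[of "(\<lambda>R. \<bar>med (S R) - med Q\<bar>) ` F" "\<bar>med (S R) - med Q\<bar>", folded t_def] F(1) R
      by fastforce
    then have "\<alpha> < \<bar>med (S R) - c\<bar>"
      using median_of_child_near_center[OF Q _ c(3), of Q] by auto
    then have "vol (S R) / 2 \<le> vol {x \<in> S R. f x \<notin> {c - \<alpha>..c + \<alpha>}}"
      using median_near_center[OF f med[OF S0] subcube_measure(1)[OF Q0 S0], of c \<alpha>] by fastforce
    also have "\<dots> \<le> vol (B \<inter> R)"
    proof (rule measure_mono_fmeasurable)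
      have "S R \<subseteq> R" "R \<subseteq> Q"
        using dyadic_children_subset[OF is_cube_subcube[OF Q0 sub(2)[OF R]] S(1)[OF R]]
          subcube_subset[OF cube_Q sub(1)[OF R]] by auto
      then show "{x \<in> S R. f x \<notin> {c - \<alpha>..c + \<alpha>}} \<subseteq> B \<inter> R"
        by (auto simp: B_def)
      have "{x \<in> S R. f x \<in> - {c - \<alpha>..c + \<alpha>}} \<in> lmeasurable"
        using subcube_measure(1)[OF Q0 S0] by (intro level_set_lmeasurable[OF f]) auto
      then show "{x \<in> S R. f x \<notin> {c - \<alpha>..c + \<alpha>}} \<in> sets lebesgue"
        by (auto dest: fmeasurableD)
      show "B \<inter> R \<in> lmeasurable"
        using lB subcube_measure(1)[OF Q0 sub(2)[OF R]] by (rule fmeasurable.Int)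
    qed
    finally show ?thesis
      using vol_dyadic_children[OF S(1)[OF R]] by (simp add: field_simps)
  qed
  have "vol (UNIV \<inter> \<Union>F) \<le> 2 * 2 ^ DIM('a) * vol (B \<inter> \<Union>F)"
  proof (rule vol_disjoint_Union_le[OF F(1)])
    show "disjoint F"
      using disjoint_stopping F(2) unfolding disjoint_def by blast
  qed (use subcube_measure(1)[OF Q0 sub(2)] lB big in auto)
  also have "vol (B \<inter> \<Union>F) \<le> vol B"
  proof (rule measure_mono_fmeasurable)
    show "B \<inter> \<Union>F \<in> sets lebesgue"
      using lB F(1) subcube_measure(1)[OF Q0 sub(2)] by (auto dest: fmeasurableD)
  qed (use lB in auto)
  also have "vol B \<le> lam * vol Q"
    using c(3) by (simp add: B_def)
  finally show ?thesis
    by (simp add: lam)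
qed simp

lemma stopping_Union:
  shows "\<Union>(stopping_cubes Q) \<in> lmeasurable" "vol (\<Union>(stopping_cubes Q)) \<le> vol Q / 2"
  by (rule fmeasurable_Union_bound[where B = "vol Q / 2"] measure_Union_bound;
      blast intro: countable_stopping vol_finite_stopping subcube_measure(1)[OF Q0] stopping_subcube(2))+

text \<open>Off the stopping cubes no subcube around a point jumps. If \<open>f\<close> took values in \<open>B\<close> on a set of
positive measure there, it would do so on more than half of some subcube, whose median then lies
in \<open>B\<close>; the parent of this subcube jumps.\<close>

lemma null_off_stopping:
  assumes B: "is_interval B" "B \<in> sets borel"
    and far: "\<And>y. y \<in> B \<Longrightarrow> 2 * oscillation lam f Q < ennreal \<bar>y - med Q\<bar>"
  shows "{x \<in> Q - \<Union>(stopping_cubes Q). f x \<in> B} \<in> null_sets lebesgue"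
proof (rule ccontr)
  define A where "A = {x \<in> Q - \<Union>(stopping_cubes Q). f x \<in> B}"
  assume "{x \<in> Q - \<Union>(stopping_cubes Q). f x \<in> B} \<notin> null_sets lebesgue"
  then have "A \<notin> null_sets lebesgue"
    by (simp add: A_def)
  moreover have lA: "A \<in> lmeasurable"
    unfolding A_def using stopping_Union(1) subcube_measure(1)[OF Q0 Q] B(2)
    by (intro level_set_lmeasurable[OF f]) auto
  ultimately have "vol A \<noteq> 0"
    using emeasure_lmeasurable[OF lA]
    by (auto simp: null_sets_def simp del: emeasure_completion dest: fmeasurableD)
  then have "0 < vol A"
    using measure_nonneg[of lebesgue A] by linarith
  moreover have "A \<subseteq> Q"
    by (auto simp: A_def)
  ultimately obtain R where R: "R \<in> dyadic_subcubes Q" "vol R / 2 < vol (A \<inter> R)"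
    using dense_subcube[OF cube_Q] lA by (auto dest: fmeasurableD)
  have R0: "R \<in> dyadic_subcubes Q0"
    using dyadic_subcubes_trans[OF R(1) Q] .
  have lR: "R \<in> lmeasurable"
    using subcube_measure(1)[OF Q0 R0] .
  have "vol (A \<inter> R) \<le> vol {x \<in> R. f x \<in> B}"
    using lA lR level_set_lmeasurable[OF f B(2) lR]
    by (intro measure_mono_fmeasurable) (auto simp: A_def dest: fmeasurableD)
  then have "med R \<in> B"
    using median_in_majority_interval[OF f med[OF R0] lR B] R(2) by linarith
  then have jump: "2 * oscillation lam f Q < ennreal \<bar>med R - med Q\<bar>"
    by (rule far)
  from R(1) show False
  proof cases
    case self
    then show ?thesis
      using jump by simp
  next
    case (child S)
    then obtain M where "M \<in> stopping_cubes Q" "S \<subseteq> M"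
      using jump subset_maximal_subcube[OF cube_Q child(1), of "jumps Q"]
      by (auto simp: jumps_def stopping_cubes_def)
    moreover have "R \<subseteq> S"
      using dyadic_children_subset[OF is_cube_subcube[OF cube_Q child(1)] child(2)] .
    ultimately have "A \<inter> R = {}"
      by (auto simp: A_def)
    then show ?thesis
      using R(2) subcube_measure(2)[OF Q0 R0] by simp
  qed
qed

lemma near_median_off_stopping:
  "AE x in lebesgue. x \<in> Q - \<Union>(stopping_cubes Q) \<longrightarrow>
     ennreal \<bar>f x - med Q\<bar> \<le> 2 * oscillation lam f Q"
proof (cases "2 * oscillation lam f Q")
  case (real r)
  let ?U = "\<Union>(stopping_cubes Q)"
  have "{x \<in> Q - ?U. f x \<in> {med Q + r<..}} \<in> null_sets lebesgue"
    using real by (intro null_off_stopping) (auto simp: is_interval_1 ennreal_less_iff)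
  moreover have "{x \<in> Q - ?U. f x \<in> {..<med Q - r}} \<in> null_sets lebesgue"
    using real by (intro null_off_stopping) (auto simp: is_interval_1 ennreal_less_iff)
  ultimately have "AE x in lebesgue. x \<notin> {x \<in> Q - ?U. f x \<in> {med Q + r<..}} \<and>
      x \<notin> {x \<in> Q - ?U. f x \<in> {..<med Q - r}}"
    by (intro AE_conjI AE_not_in)
  then show ?thesis
    by (rule eventually_mono) (auto simp: real intro!: ennreal_leI)
qed simp

end

section \<open>The sparse family\<close>

primrec stopping_generation :: "nat \<Rightarrow> 'a set set" where
  "stopping_generation 0 = {Q0}"
| "stopping_generation (Suc n) = (\<Union>Q\<in>stopping_generation n. stopping_cubes Q)"

lemma stopping_generation_subcube:
  "Q \<in> stopping_generation n \<Longrightarrow> Q \<in> dyadic_subcubes Q0"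
  by (induction n arbitrary: Q) (auto intro: dyadic_subcubes.self dest: stopping_subcube(2)[rotated])

lemma countable_stopping_generation: "countable (stopping_generation n)"
  by (induction n) (auto intro: countable_stopping stopping_generation_subcube)

lemma disjoint_stopping_generation: "disjoint (stopping_generation n)"
proof (induction n)
  case (Suc n)
  show ?case
  proof (rule disjointI)
    fix R R' assume R: "R \<in> stopping_generation (Suc n)" "R' \<in> stopping_generation (Suc n)" "R \<noteq> R'"
    then obtain Q Q' where Q: "Q \<in> stopping_generation n" "R \<in> stopping_cubes Q"
      "Q' \<in> stopping_generation n" "R' \<in> stopping_cubes Q'"
      by auto
    have "R \<subseteq> Q" "R' \<subseteq> Q'"
      using stopping_psubset[OF stopping_generation_subcube] Q by blast+
    then show "R \<inter> R' = {}"
      using disjoint_stopping[OF stopping_generation_subcube[OF Q(1)]] disjointD[OF Suc Q(1,3)] Q R(3)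
      unfolding disjoint_def by blast
  qed
qed simp

lemma Union_stopping_generation_Suc:
  "\<Union>(stopping_generation (Suc n)) \<subseteq> \<Union>(stopping_generation n)"
  using stopping_psubset[OF stopping_generation_subcube] by fastforce

lemma Union_stopping_generation_mono:
  "n \<le> k \<Longrightarrow> \<Union>(stopping_generation k) \<subseteq> \<Union>(stopping_generation n)"
  by (induction rule: dec_induct) (use Union_stopping_generation_Suc in blast)+

text \<open>Stopping cubes of other cubes of the same generation do not meet \<open>Q\<close>.\<close>

lemma stopping_generation_off_next:
  assumes "Q \<in> stopping_generation n" "x \<in> Q" "x \<notin> \<Union>(stopping_cubes Q)"
  shows "x \<notin> \<Union>(stopping_generation (Suc n))"
proof
  assume "x \<in> \<Union>(stopping_generation (Suc n))"
  then obtain Q' where Q': "Q' \<in> stopping_generation n" "x \<in> \<Union>(stopping_cubes Q')"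
    by auto
  then have "x \<in> Q'"
    using stopping_psubset[OF stopping_generation_subcube[OF Q'(1)]] by blast
  then have "Q = Q'"
    using disjointD[OF disjoint_stopping_generation assms(1) Q'(1)] assms(2) by blast
  then show False
    using Q'(2) assms(3) by simp
qed

lemma vol_stopping_generation:
  "\<Union>(stopping_generation n) \<in> lmeasurable \<and> vol (\<Union>(stopping_generation n)) \<le> vol Q0 / 2 ^ n"
proof (induction n)
  case 0
  then show ?case
    using cube_measure(1)[OF Q0] by simp
next
  case (Suc n)
  let ?V = "\<Union>(stopping_generation n)" and ?U = "\<lambda>Q. \<Union>(stopping_cubes Q)"
  note sub = stopping_generation_subcube[of _ n]
  have finite_le: "vol (\<Union>Q\<in>F. ?U Q) \<le> vol ?V / 2" if F: "F \<subseteq> stopping_generation n" "finite F" for F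
  proof -
    have lm: "Q \<in> lmeasurable" if "Q \<in> F" for Q
      using subcube_measure(1)[OF Q0 sub] that F(1) by blast
    have "vol (\<Union>Q\<in>F. ?U Q) \<le> (\<Sum>Q\<in>F. vol (?U Q))"
      using F stopping_Union(1)[OF sub] by (intro measure_UNION_le) (auto dest!: fmeasurableD)
    also have "\<dots> \<le> (\<Sum>Q\<in>F. vol Q / 2)"
      using F(1) stopping_Union(2)[OF sub] by (intro sum_mono) auto
    also have "\<dots> = vol (\<Union>F) / 2"
      using measure_Union'[OF F(2), of lebesgue] lm disjoint_stopping_generation[of n] F(1)
      by (simp add: sum_divide_distrib[symmetric] pairwise_def disjnt_def disjoint_def subset_iff)
    also have "vol (\<Union>F) \<le> vol ?V"
      using F lm Suc by (intro measure_mono_fmeasurable) (auto dest!: fmeasurableD)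
    finally show ?thesis
      by simp
  qed
  have "\<Union>(stopping_generation (Suc n)) = (\<Union>Q\<in>stopping_generation n. ?U Q)"
    by auto
  moreover have "(\<Union>Q\<in>stopping_generation n. ?U Q) \<in> lmeasurable"
    using finite_le by (intro fmeasurable_UN_bound[OF countable_stopping_generation stopping_Union(1)[OF sub]])
  moreover have "vol (\<Union>Q\<in>stopping_generation n. ?U Q) \<le> vol ?V / 2"
    using finite_le by (intro measure_UN_bound[OF countable_stopping_generation stopping_Union(1)[OF sub]])
  moreover have "vol ?V / 2 \<le> vol Q0 / 2 ^ Suc n"
    using Suc by simp
  ultimately show ?case
    by simp
qed

text \<open>The cubes of the earlier generations that contain \<open>Q\<close> telescope the difference of the medians.
Recording that all cubes of \<open>F\<close> strictly contain \<open>Q\<close> keeps them distinct, so that each oscillation is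
counted once.\<close>

lemma median_chain:
  assumes "Q \<in> stopping_generation n" "x \<in> Q"
  shows "\<exists>F. finite F \<and> F \<subseteq> {L \<in> (\<Union>k. stopping_generation k). x \<in> L \<and> Q \<subset> L} \<and>
    ennreal \<bar>med Q - med Q0\<bar> \<le> (\<Sum>L\<in>F. 2 * oscillation lam f L)"
  using assms
proof (induction n arbitrary: Q)
  case 0
  then show ?case
    by (intro exI[of _ "{}"]) simp
next
  case (Suc n)
  then obtain P where P: "P \<in> stopping_generation n" "Q \<in> stopping_cubes P"
    by auto
  have QP: "Q \<subset> P"
    using stopping_psubset[OF stopping_generation_subcube[OF P(1)] P(2)] .
  then obtain F where F: "finite F" "F \<subseteq> {L \<in> (\<Union>k. stopping_generation k). x \<in> L \<and> P \<subset> L}"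
    "ennreal \<bar>med P - med Q0\<bar> \<le> (\<Sum>L\<in>F. 2 * oscillation lam f L)"
    using Suc.IH[OF P(1)] Suc.prems(2) by blast
  have "P \<notin> F"
    using F(2) by blast
  have "ennreal \<bar>med Q - med Q0\<bar> \<le> ennreal (\<bar>med Q - med P\<bar> + \<bar>med P - med Q0\<bar>)"
    by (intro ennreal_leI) simp
  also have "\<dots> = ennreal \<bar>med Q - med P\<bar> + ennreal \<bar>med P - med Q0\<bar>"
    by (simp add: ennreal_plus)
  also have "\<dots> \<le> (\<Sum>L\<in>insert P F. 2 * oscillation lam f L)"
    using add_mono[OF stopping_median_le[OF stopping_generation_subcube[OF P(1)] P(2)] F(3)]
      F(1) \<open>P \<notin> F\<close> by simp
  finally show ?case
    using F(1,2) P(1) QP Suc.prems(2) by (intro exI[of _ "insert P F"]) blast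
qed

lemma bounded_off_stopping:
  assumes "Q \<in> stopping_generation n" "x \<in> Q"
    and "ennreal \<bar>f x - med Q\<bar> \<le> 2 * oscillation lam f Q"
  shows "ennreal \<bar>f x - med Q0\<bar> \<le>
    2 * (\<Sum>\<^sub>\<infinity>L\<in>(\<Union>k. stopping_generation k). oscillation lam f L * indicator L x)"
proof -
  let ?L = "\<Union>k. stopping_generation k" and ?o = "\<lambda>L. oscillation lam f L * indicator L x"
  obtain F where F: "finite F" "F \<subseteq> {L \<in> ?L. x \<in> L \<and> Q \<subset> L}"
    "ennreal \<bar>med Q - med Q0\<bar> \<le> (\<Sum>L\<in>F. 2 * oscillation lam f L)"
    using median_chain[OF assms(1,2)] by blast
  have "Q \<notin> F"
    using F(2) by blast
  have "ennreal \<bar>f x - med Q0\<bar> \<le> ennreal (\<bar>f x - med Q\<bar> + \<bar>med Q - med Q0\<bar>)"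
    by (intro ennreal_leI) simp
  also have "\<dots> = ennreal \<bar>f x - med Q\<bar> + ennreal \<bar>med Q - med Q0\<bar>"
    by (simp add: ennreal_plus)
  also have "\<dots> \<le> (\<Sum>L\<in>insert Q F. 2 * oscillation lam f L)"
    using add_mono[OF assms(3) F(3)] F(1) \<open>Q \<notin> F\<close> by simp
  also have "\<dots> = 2 * (\<Sum>L\<in>insert Q F. ?o L)"
    unfolding sum_distrib_left using F(2) assms(2) by (intro sum.cong) (auto simp: subset_iff)
  also have "(\<Sum>L\<in>insert Q F. ?o L) = infsum ?o (insert Q F)"
    using F(1) by simp
  also have "\<dots> \<le> infsum ?o ?L"
  proof (rule infsum_mono_neutral)
    show "?o summable_on insert Q F"
      by (rule nonneg_summable_on_complete) simp
    show "?o summable_on ?L"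
      by (rule nonneg_summable_on_complete) simp
    have "insert Q F \<subseteq> ?L"
      using F(2) assms(1) by blast
    then show "?o L \<le> 0" if "L \<in> insert Q F - ?L" for L
      using that by blast
  qed auto
  finally show ?thesis
    by (simp add: mult_left_mono)
qed

text \<open>Since the generations shrink geometrically, almost every point lies in only finitely many of
them, and hence in \<open>Q - \<Union>(stopping_cubes Q)\<close> for a cube \<open>Q\<close> of the last one.\<close>

lemma stopping_family_bounds:
  "AE x in lebesgue. x \<in> Q0 \<longrightarrow> ennreal \<bar>f x - med Q0\<bar> \<le>
    2 * (\<Sum>\<^sub>\<infinity>L\<in>(\<Union>k. stopping_generation k). oscillation lam f L * indicator L x)"
proof -
  let ?L = "\<Union>k. stopping_generation k" and ?N = "\<Inter>n. \<Union>(stopping_generation n)"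
  have "AE x in lebesgue. \<forall>Q\<in>?L. x \<in> Q - \<Union>(stopping_cubes Q) \<longrightarrow>
      ennreal \<bar>f x - med Q\<bar> \<le> 2 * oscillation lam f Q"
    using near_median_off_stopping stopping_generation_subcube countable_stopping_generation
    by (subst AE_ball_countable) auto
  moreover have "AE x in lebesgue. x \<notin> ?N"
  proof (rule AE_not_in)
    have sets: "?N \<in> sets lebesgue"
      using vol_stopping_generation by (auto dest!: fmeasurableD)
    have le: "vol ?N \<le> vol Q0 / 2 ^ n" for n
      using measure_mono_fmeasurable[OF _ sets, of "\<Union>(stopping_generation n)"] vol_stopping_generation[of n]
      by (meson INT_lower UNIV_I order_trans)
    have "(\<lambda>n. vol Q0 * (1 / 2) ^ n) \<longlonglongrightarrow> vol Q0 * 0"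
      by (intro tendsto_mult_left LIMSEQ_realpow_zero) auto
    then have "vol ?N \<le> 0"
      using le by (intro LIMSEQ_le_const[of "\<lambda>n. vol Q0 * (1 / 2) ^ n" 0]) (auto simp: power_divide)
    moreover have "?N \<in> lmeasurable"
      using fmeasurableI2[OF _ _ sets, of "\<Union>(stopping_generation 0)"] vol_stopping_generation[of 0]
      by blast
    ultimately show "?N \<in> null_sets lebesgue"
      using sets emeasure_lmeasurable[of ?N] measure_nonneg[of lebesgue ?N]
      by (auto simp: null_sets_def simp del: emeasure_completion)
  qed
  ultimately show ?thesis
  proof eventually_elim
    case (elim x)
    show ?case
    proof
      assume "x \<in> Q0"
      then have x0: "x \<in> \<Union>(stopping_generation 0)"
        by simp
      obtain k where "x \<notin> \<Union>(stopping_generation k)"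
        using elim(2) by blast
      then obtain n where n: "x \<in> \<Union>(stopping_generation n)" "x \<notin> \<Union>(stopping_generation (Suc n))"
        using x0 by (induction k) blast+
      then obtain Q where Q: "Q \<in> stopping_generation n" "x \<in> Q"
        by blast
      then have "x \<notin> \<Union>(stopping_cubes Q)"
        using n(2) by auto
      then show "ennreal \<bar>f x - med Q0\<bar> \<le>
          2 * (\<Sum>\<^sub>\<infinity>L\<in>?L. oscillation lam f L * indicator L x)"
        using elim(1) Q by (intro bounded_off_stopping[OF Q]) blast
    qed
  qed
qed

lemma stopping_family_sparse: "sparse_family (1 / 2) (\<Union>k. stopping_generation k)"
  unfolding sparse_family_def
proof (intro exI conjI ballI)
  let ?E = "\<lambda>Q. Q - \<Union>(stopping_cubes Q)"
  \<comment> \<open>A cube of a later generation lies in the next generation after that of \<open>Q\<close>, which \<open>?E Q\<close>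
    avoids.\<close>
  have earlier: "?E Q \<inter> ?E R = {}"
    if "Q \<in> stopping_generation n" "R \<in> stopping_generation k" "n < k" for Q R n k
  proof -
    have "R \<subseteq> \<Union>(stopping_generation (Suc n))"
      using Union_stopping_generation_mono[of "Suc n" k] that(2,3) by auto
    then show ?thesis
      using stopping_generation_off_next[OF that(1)] by blast
  qed
  show "disjoint_family_on ?E (\<Union>k. stopping_generation k)"
    unfolding disjoint_family_on_def
  proof (intro ballI impI)
    fix Q R assume "Q \<in> (\<Union>k. stopping_generation k)" "R \<in> (\<Union>k. stopping_generation k)" "Q \<noteq> R"
    then obtain n k where "Q \<in> stopping_generation n" "R \<in> stopping_generation k"
      by blast
    then show "?E Q \<inter> ?E R = {}"
      using earlier[of Q n R k] earlier[of R k Q n] \<open>Q \<noteq> R\<close>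
        disjointD[OF disjoint_stopping_generation, of Q n R]
      by (cases n k rule: linorder_cases) blast+
  qed
  fix Q assume "Q \<in> (\<Union>k. stopping_generation k)"
  then have Q: "Q \<in> dyadic_subcubes Q0"
    using stopping_generation_subcube by blast
  note l = subcube_measure(1)[OF Q0 Q] stopping_Union[OF Q]
  show E: "?E Q \<in> sets lebesgue"
    using l by (auto dest!: fmeasurableD)
  have lE: "?E Q \<in> lmeasurable"
    using fmeasurableI2[OF l(1) _ E] by blast
  show "?E Q \<subseteq> Q"
    by blast
  have "\<Union>(stopping_cubes Q) \<subseteq> Q"
    using stopping_psubset[OF Q] by blast
  then have "vol (?E Q) = vol Q - vol (\<Union>(stopping_cubes Q))"
    using l by (intro measurable_measure_Diff) (auto dest: fmeasurableD)
  then have "1 / 2 * vol Q \<le> vol (?E Q)"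
    using l(3) by simp
  then have "ennreal (1 / 2 * vol Q) \<le> ennreal (vol (?E Q))"
    by (rule ennreal_leI)
  then show "ennreal (1 / 2) * emeasure lebesgue Q \<le> emeasure lebesgue (?E Q)"
    unfolding emeasure_lmeasurable[OF l(1)] emeasure_lmeasurable[OF lE] by (simp only: ennreal_mult')
qed

end

section \<open>Lerner's formula\<close>

theorem theorem2p3:
  fixes Q0 :: "'a::euclidean_space set" and f :: "'a \<Rightarrow> real" and m lam :: real
  assumes "is_cube Q0"
    and "f \<in> borel_measurable (lebesgue_on Q0)"
    and "is_median f Q0 m"
    and "lam = 2 powi (- int DIM('a) - 2)"
  shows "\<exists>\<L>. \<L> \<subseteq> dyadic_subcubes Q0 \<and>
           (AE x in lebesgue_on Q0.
              ennreal \<bar>f x - m\<bar> \<le> 2 * (\<Sum>\<^sub>\<infinity>L\<in>\<L>. oscillation lam f L * indicator L x)) \<and>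
           sparse_family (1 / 2) \<L>"
proof -
  have Q0_sets: "Q0 \<in> sets lebesgue"
    using cube_measure(1)[OF assms(1)] by (rule fmeasurableD)
  \<comment> \<open>Medians and oscillations on subcubes only see \<open>f\<close> on \<open>Q0\<close>, so \<open>f\<close> may be replaced by its
    extension by zero, which is measurable on the whole space.\<close>
  define g where "g = (\<lambda>x. indicat_real Q0 x *\<^sub>R f x)"
  have g: "g \<in> borel_measurable lebesgue"
    using assms(2) Q0_sets unfolding g_def by (subst (asm) borel_measurable_restrict_space_iff) auto
  have g_eq: "g x = f x" if "x \<in> Q0" for x
    using that by (simp add: g_def)
  have g_oscillation: "oscillation lam g L = oscillation lam f L" if "L \<subseteq> Q0" for L
  proof -
    have "(\<lambda>x. indicat_real L x * (g x - c)) = (\<lambda>x. indicator L x * (f x - c))" for c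
      using that g_eq by (intro ext) (auto simp: indicator_def)
    then show ?thesis
      unfolding oscillation_def by presburger
  qed
  have "{x \<in> Q0. g x > m} = {x \<in> Q0. f x > m}" "{x \<in> Q0. g x < m} = {x \<in> Q0. f x < m}"
    using g_eq by auto
  then have g_median: "is_median g Q0 m"
    using assms(3) by (simp add: is_median_def)
  \<comment> \<open>On \<open>Q0\<close> the median is prescribed; on the other subcubes any choice will do.\<close>
  define med where "med = (\<lambda>R. if R = Q0 then m else SOME y. is_median g R y)"
  have med: "is_median g R (med R)" if "R \<in> dyadic_subcubes Q0" for R
    using g_median someI_ex[OF median_exists[OF g subcube_measure[OF assms(1) that]]]
    by (simp add: med_def)
  have lam: "lam = 1 / (4 * 2 ^ DIM('a))"
    unfolding assms(4) by (simp add: power_int_diff power_int_minus field_simps)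
  define \<L> where "\<L> = (\<Union>k. stopping_generation g Q0 med lam k)"
  have sub: "\<L> \<subseteq> dyadic_subcubes Q0"
    unfolding \<L>_def using stopping_generation_subcube[OF g assms(1) _ lam] med by blast
  have bounds: "AE x in lebesgue. x \<in> Q0 \<longrightarrow> ennreal \<bar>g x - med Q0\<bar> \<le>
      2 * (\<Sum>\<^sub>\<infinity>L\<in>(\<Union>k. stopping_generation g Q0 med lam k). oscillation lam g L * indicator L x)"
    by (rule stopping_family_bounds[OF g assms(1) _ lam]) (rule med)
  have "AE x in lebesgue. x \<in> Q0 \<longrightarrow>
      ennreal \<bar>f x - m\<bar> \<le> 2 * (\<Sum>\<^sub>\<infinity>L\<in>\<L>. oscillation lam f L * indicator L x)"
    using bounds
  proof (rule eventually_mono, intro impI)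
    fix x assume "x \<in> Q0 \<longrightarrow> ennreal \<bar>g x - med Q0\<bar> \<le>
      2 * (\<Sum>\<^sub>\<infinity>L\<in>(\<Union>k. stopping_generation g Q0 med lam k). oscillation lam g L * indicator L x)"
      and x: "x \<in> Q0"
    then have "ennreal \<bar>f x - m\<bar> \<le> 2 * (\<Sum>\<^sub>\<infinity>L\<in>\<L>. oscillation lam g L * indicator L x)"
      using g_eq[OF x] by (simp add: med_def \<L>_def)
    also have "(\<Sum>\<^sub>\<infinity>L\<in>\<L>. oscillation lam g L * indicator L x) =
        (\<Sum>\<^sub>\<infinity>L\<in>\<L>. oscillation lam f L * indicator L x)"
      using sub subcube_subset[OF assms(1)] g_oscillation by (intro infsum_cong) auto
    finally show "ennreal \<bar>f x - m\<bar> \<le> 2 * (\<Sum>\<^sub>\<infinity>L\<in>\<L>. oscillation lam f L * indicator L x)" .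
  qed
  then have "AE x in lebesgue_on Q0.
      ennreal \<bar>f x - m\<bar> \<le> 2 * (\<Sum>\<^sub>\<infinity>L\<in>\<L>. oscillation lam f L * indicator L x)"
    using Q0_sets by (subst AE_restrict_space_iff) auto
  moreover have "sparse_family (1 / 2) \<L>"
    unfolding \<L>_def by (rule stopping_family_sparse[OF g assms(1) _ lam]) (rule med)
  ultimately show ?thesis
    using sub by blast
qed

end
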